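(* Let $S=(S,+,\cdot,\leqslant,\lim)$ be a system satisfying conditions (S1)–(S11) listed in the context. If $a,b,c\in S$, $b$ is bounded, $c$ is convex and $a+b\leqslant b+c$, then $a\leqslant c$.
   Context: Let $\mathbb{Q}_2^{+}$ be the set of all non-negative dyadic rationals. Consider a system $S=(S,+,\cdot,\leqslant,\lim)$, where $+:S\times S\to S$ and $\cdot:\mathbb{Q}_2^{+}\times S\to S$ are operations, $\leqslant$ is a partial order on $S$, and $\lim$ is a limit operator, assigning to some sequences in $S$ (called convergent) an element of $S$ (the limit), and turning $S$ into an $\mathcal{L}^{\ast}$-space: (1) if $a_n=a$ for all $n$ then $\lim a_n=a$; (2) if $\lim a_n=a$ then $\lim a_{k_n}=a$ for every subsequence $(a_{k_n})$; (3) if $(a_n)$ does not converge to $a$ then there exists a subsequence $(a_{k_n})$ such that no subsequence of $(a_{k_n})$ converges to $a$. The conditions are: (S1) $a+(b+c)=(a+b)+c$ for all $a,b,c\in S$; (S2) $a+b=b+a$ for all $a,b\in S$; (S3) there exists $0\in S$ such that $a+0=a$ for all $a\in S$; (S4) if $a\leqslant b$ then $a+c\leqslant b+c$, for all $a,b,c\in S$; (S5) $1\cdot a=a$ for all $a\in S$; (S6) if $a\leqslant b$ then $\alpha\cdot a\leqslant\alpha\cdot b$, for all $a,b\in S$, $\alpha\in\mathbb{Q}_2^{+}$; (S7) $\alpha\cdot(\beta\cdot a)=(\alpha\beta)\cdot a$ for all $\alpha,\beta\in\mathbb{Q}_2^{+}$, $a\in S$; (S8) $\alpha\cdot(a+b)=\alpha\cdot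 a+\alpha\cdot b$ for all $\alpha\in\mathbb{Q}_2^{+}$, $a,b\in S$; (S9) $(\alpha+\beta)\cdot a\leqslant\alpha\cdot a+\beta\cdot a$ for all $\alpha,\beta\in\mathbb{Q}_2^{+}$, $a\in S$; (S10) for all sequences $(a_n),(b_n)\subset S$, if $\lim_{n\to\infty}a_n=a$, $\lim_{n\to\infty}b_n=b$ and $a_n\leqslant b_n$ for all $n\in\mathbb{N}$, then $a\leqslant b$; (S11) for every sequence $(a_n)\subset S$ and $b\in S$, if $\lim_{n\to\infty}a_n=a$ then $\lim_{n\to\infty}(a_n+b)=a+b$. An element $a\in S$ is bounded if $\lim_{n\to\infty}(2^{-n}\cdot a)=0$. An element $a\in S$ is convex if $(\alpha+\beta)\cdot a=\alpha\cdot a+\beta\cdot a$ for all $\alpha,\beta\in\mathbb{Q}_2^{+}$. *)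

theory Defs
  imports Complex_Main
begin

definition nonneg_dyadics :: "rat set" where
  "nonneg_dyadics = {of_nat m / 2 ^ n | m n. True}"

text \<open>
  The limit operator is a partial function on sequences: \<open>lm x = Some a\<close> means that \<open>x\<close>
  converges with limit \<open>a\<close>, and \<open>lm x = None\<close> that \<open>x\<close> is not convergent.
\<close>

locale Lstar_space =
  fixes lm :: "(nat \<Rightarrow> 'a) \<Rightarrow> 'a option"
  assumes lim_const: "lm (\<lambda>n. a) = Some a"
    and lim_subseq: "lm x = Some a \<Longrightarrow> strict_mono k \<Longrightarrow> lm (x \<circ> k) = Some a"
    and lim_Urysohn: "lm x \<noteq> Some a \<Longrightarrow>
      \<exists>k::nat \<Rightarrow> nat. strict_mono k \<and>
        (\<forall>j::nat \<Rightarrow> nat. strict_mono j \<longrightarrow> lm (x \<circ> k \<circ> j) \<noteq> Some a)"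

text \<open>
  The underlying set is the type \<open>'a\<close>. The partial order and the axioms on addition
  (associativity, commutativity, neutral element, monotonicity) come from the class
  \<^class>\<open>ordered_comm_monoid_add\<close>. The scalar multiplication is a function on all of
  \<^typ>\<open>rat\<close>, but nothing is assumed about its values at scalars outside
  \<^const>\<open>nonneg_dyadics\<close>.
\<close>

locale ordered_dyadic_system = Lstar_space lm
  for lm :: "(nat \<Rightarrow> 'a::ordered_comm_monoid_add) \<Rightarrow> 'a option"
    and smul :: "rat \<Rightarrow> 'a \<Rightarrow> 'a" +
  assumes smul_one: "smul 1 a = a"
    and smul_mono: "\<alpha> \<in> nonneg_dyadics \<Longrightarrow> a \<le> b \<Longrightarrow> smul \<alpha> a \<le> smul \<alpha> b"
    and smul_smul: "\<alpha> \<in> nonneg_dyadics \<Longrightarrow> \<beta> \<in> nonneg_dyadics \<Longrightarrow>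
      smul \<alpha> (smul \<beta> a) = smul (\<alpha> * \<beta>) a"
    and smul_add_right: "\<alpha> \<in> nonneg_dyadics \<Longrightarrow> smul \<alpha> (a + b) = smul \<alpha> a + smul \<alpha> b"
    and smul_add_left_le: "\<alpha> \<in> nonneg_dyadics \<Longrightarrow> \<beta> \<in> nonneg_dyadics \<Longrightarrow>
      smul (\<alpha> + \<beta>) a \<le> smul \<alpha> a + smul \<beta> a"
    and lim_mono: "lm x = Some a \<Longrightarrow> lm y = Some b \<Longrightarrow> (\<And>n. x n \<le> y n) \<Longrightarrow> a \<le> b"
    and lim_add_const: "lm x = Some a \<Longrightarrow> lm (\<lambda>n. x n + b) = Some (a + b)"

definition bounded_element ::
    "((nat \<Rightarrow> 'a::zero) \<Rightarrow> 'a option) \<Rightarrow> (rat \<Rightarrow> 'a \<Rightarrow> 'a) \<Rightarrow> 'a \<Rightarrow> bool" where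
  "bounded_element lm smul a \<longleftrightarrow> lm (\<lambda>n. smul (1 / 2 ^ n) a) = Some 0"

definition convex_element :: "(rat \<Rightarrow> 'a::plus \<Rightarrow> 'a) \<Rightarrow> 'a \<Rightarrow> bool" where
  "convex_element smul a \<longleftrightarrow>
    (\<forall>\<alpha>\<in>nonneg_dyadics. \<forall>\<beta>\<in>nonneg_dyadics. smul (\<alpha> + \<beta>) a = smul \<alpha> a + smul \<beta> a)"

end

theory Submission imports Defs begin

text \<open>
  For convex \<open>c\<close>, the inequality \<open>a + b \<le> b + c\<close> survives replacing \<open>b\<close> by half of it
  (lemma \<open>halve_summand\<close>). Iterating gives \<open>a + 2\<^sup>-\<^sup>n b \<le> 2\<^sup>-\<^sup>n b + c\<close> for all \<open>n\<close>.
  Boundedness of \<open>b\<close> says exactly that \<open>2\<^sup>-\<^sup>n b\<close> tends to \<open>0\<close>, so \<open>b\<close> disappears in the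
  limit and \<open>a \<le> c\<close> remains.
\<close>

context ordered_dyadic_system
begin

lemma inverse_power_two_dyadic: "1 / 2 ^ n \<in> nonneg_dyadics"
  unfolding nonneg_dyadics_def by (metis (mono_tags, lifting) mem_Collect_eq of_nat_1)

lemma half_dyadic: "1 / 2 \<in> nonneg_dyadics"
  using inverse_power_two_dyadic[of 1] by simp

text \<open>
  Using the hypothesis twice gives \<open>a + a + b \<le> b + c + c\<close>, which is then multiplied by
  \<open>1 / 2\<close>. On the left, \<open>a \<le> a / 2 + a / 2\<close> holds for every \<open>a\<close> by subdistributivity; on the
  right \<open>c / 2 + c / 2\<close> has to collapse to \<open>c\<close>, which is where convexity enters.
\<close>
lemma halve_summand:
  assumes "convex_element smul c" and le: "a + b \<le> b + c"
  shows "a + smul (1 / 2) b \<le> smul (1 / 2) b + c"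
proof -
  let ?h = "smul (1 / 2)"
  have "a + a + b \<le> a + (b + c)"
    using add_left_mono[OF le, of a] by (simp add: add.assoc)
  also have "\<dots> \<le> b + c + c"
    using add_right_mono[OF le, of c] by (simp add: add.assoc)
  finally have "?h (a + a + b) \<le> ?h (b + c + c)"
    by (rule smul_mono[OF half_dyadic])
  then have halved: "?h a + ?h a + ?h b \<le> ?h b + (?h c + ?h c)"
    by (simp add: smul_add_right[OF half_dyadic] add.assoc)
  have "a \<le> ?h a + ?h a"
    using smul_add_left_le[OF half_dyadic half_dyadic, of a] by (simp add: smul_one)
  then have "a + ?h b \<le> ?h a + ?h a + ?h b"
    by (rule add_right_mono)
  also note halved
  also have "?h c + ?h c = smul (1 / 2 + 1 / 2) c"
    using assms(1) half_dyadic unfolding convex_element_def by metis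
  also have "\<dots> = c"
    by (simp add: smul_one)
  finally show ?thesis .
qed

lemma scale_summand_inverse_power_two:
  assumes "convex_element smul c" and "a + b \<le> b + c"
  shows "a + smul (1 / 2 ^ n) b \<le> smul (1 / 2 ^ n) b + c"
proof (induction n)
  case 0
  then show ?case using assms(2) by (simp add: smul_one)
next
  case (Suc n)
  have "smul (1 / 2 ^ Suc n) b = smul (1 / 2) (smul (1 / 2 ^ n) b)"
    by (simp add: smul_smul[OF half_dyadic inverse_power_two_dyadic])
  then show ?case
    using halve_summand[OF assms(1) Suc.IH] by simp
qed

lemma bounded_summand_cancel:
  assumes "bounded_element lm smul b" and "convex_element smul c" and "a + b \<le> b + c"
  shows "a \<le> c"
proof (rule lim_mono)
  have null: "lm (\<lambda>n. smul (1 / 2 ^ n) b) = Some 0"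
    using assms(1) unfolding bounded_element_def .
  show "lm (\<lambda>n. smul (1 / 2 ^ n) b + a) = Some a"
    using lim_add_const[OF null, of a] by simp
  show "lm (\<lambda>n. smul (1 / 2 ^ n) b + c) = Some c"
    using lim_add_const[OF null, of c] by simp
  show "smul (1 / 2 ^ n) b + a \<le> smul (1 / 2 ^ n) b + c" for n
    using scale_summand_inverse_power_two[OF assms(2,3), of n] by (simp add: add.commute)
qed

end

theorem theorem2p4:
  fixes lm :: "(nat \<Rightarrow> 'a::ordered_comm_monoid_add) \<Rightarrow> 'a option"
    and smul :: "rat \<Rightarrow> 'a \<Rightarrow> 'a"
    and a b c :: 'a
  assumes "ordered_dyadic_system lm smul"
    and "bounded_element lm smul b"
    and "convex_element smul c"
    and "a + b \<le> b + c"
  shows "a \<le> c"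
  using assms by (rule ordered_dyadic_system.bounded_summand_cancel)

end
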